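(* For every map of sets $f: S \to T$, the map $\beta f: \beta S \to \beta T$ is open.
   Context: For a set $S$, $\beta S$ denotes the Stone–Čech compactification of the (discrete) set $S$, i.e. the Stone dual of the powerset Boolean algebra $\mathcal P(S)$: the space of ultrafilters of $\mathcal P(S)$ with the topology generated by the sets $\{x \in \beta S \mid L \in x\}$, $L \subseteq S$. For a map of sets $f: S \to T$, $\beta f: \beta S \to \beta T$ is the continuous map dual to the Boolean algebra homomorphism $f^{-1}: \mathcal P(T) \to \mathcal P(S)$, i.e. $\beta f(x) = \{L \subseteq T \mid f^{-1}(L) \in x\}$. *)

theory Defs
  imports "HOL-Analysis.Analysis"
begin

definition ultrafilter_on :: "'a set \<Rightarrow> 'a set set \<Rightarrow> bool" where
  "ultrafilter_on S x \<longleftrightarrow>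
     x \<subseteq> Pow S \<and> S \<in> x \<and> {} \<notin> x \<and>
     (\<forall>A B. A \<in> x \<longrightarrow> B \<in> x \<longrightarrow> A \<inter> B \<in> x) \<and>
     (\<forall>A B. A \<in> x \<longrightarrow> A \<subseteq> B \<longrightarrow> B \<subseteq> S \<longrightarrow> B \<in> x) \<and>
     (\<forall>A. A \<subseteq> S \<longrightarrow> A \<in> x \<or> S - A \<in> x)"

definition beta_space :: "'a set \<Rightarrow> 'a set set topology" where
  "beta_space S = topology_generated_by {{x. ultrafilter_on S x \<and> L \<in> x} | L. L \<subseteq> S}"

(* f is relevant only on S, so the preimage of L under f : S \<rightarrow> T is cut down to S. *)
definition beta_map :: "'a set \<Rightarrow> 'b set \<Rightarrow> ('a \<Rightarrow> 'b) \<Rightarrow> 'a set set \<Rightarrow> 'b set set" where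
  "beta_map S T f x = {L. L \<subseteq> T \<and> f -` L \<inter> S \<in> x}"

lemma topspace_beta_space: "topspace (beta_space S) = {x. ultrafilter_on S x}"
proof (rule set_eqI)
  fix x :: "'a set set"
  have "ultrafilter_on S x \<Longrightarrow> S \<in> x"
    unfolding ultrafilter_on_def by metis
  then show "x \<in> topspace (beta_space S) \<longleftrightarrow> x \<in> {x. ultrafilter_on S x}"
    unfolding beta_space_def topology_generated_by_topspace by blast
qed

lemma ultrafilter_on_beta_map:
  assumes f: "f \<in> S \<rightarrow> T" and x: "ultrafilter_on S x"
  shows "ultrafilter_on T (beta_map S T f x)"
proof -
  have T: "f -` T \<inter> S = S"
    using f by auto
  have I: "f -` (A \<inter> B) \<inter> S = (f -` A \<inter> S) \<inter> (f -` B \<inter> S)" for A B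
    by auto
  have C: "f -` (T - A) \<inter> S = S - f -` A \<inter> S" for A
    using f by auto
  have xI: "A \<inter> B \<in> x" if "A \<in> x" "B \<in> x" for A B
    using x that unfolding ultrafilter_on_def by metis
  have xM: "B \<in> x" if "A \<in> x" "A \<subseteq> B" "B \<subseteq> S" for A B
    using x that unfolding ultrafilter_on_def by metis
  have xU: "A \<in> x \<or> S - A \<in> x" if "A \<subseteq> S" for A
    using x that unfolding ultrafilter_on_def by metis
  have M: "f -` B \<inter> S \<in> x" if "f -` A \<inter> S \<in> x" "A \<subseteq> B" for A B
    by (rule xM[OF that(1)]) (use that(2) in auto)
  have U: "f -` A \<inter> S \<in> x \<or> S - f -` A \<inter> S \<in> x" for A
    by (rule xU) simp
  have J: "f -` (A \<inter> B) \<inter> S \<in> x" if "f -` A \<inter> S \<in> x" "f -` B \<inter> S \<in> x" for A B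
    unfolding I by (rule xI[OF that])
  have S: "S \<in> x" "{} \<notin> x"
    using x unfolding ultrafilter_on_def by metis+
  show ?thesis
    unfolding ultrafilter_on_def
  proof (intro conjI allI impI)
    show "beta_map S T f x \<subseteq> Pow T"
      by (auto simp: beta_map_def)
    show "T \<in> beta_map S T f x" "{} \<notin> beta_map S T f x"
      using S T by (simp_all add: beta_map_def)
    show "A \<inter> B \<in> beta_map S T f x"
      if "A \<in> beta_map S T f x" "B \<in> beta_map S T f x" for A B
      using that J[of A B] unfolding beta_map_def by blast
    show "B \<in> beta_map S T f x"
      if "A \<in> beta_map S T f x" "A \<subseteq> B" "B \<subseteq> T" for A B
      using that M[of A B] unfolding beta_map_def by blast
    show "A \<in> beta_map S T f x \<or> T - A \<in> beta_map S T f x" if "A \<subseteq> T" for A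
      using that U[of A] unfolding beta_map_def mem_Collect_eq C by blast
  qed
qed

lemma continuous_map_beta_map:
  assumes f: "f \<in> S \<rightarrow> T"
  shows "continuous_map (beta_space S) (beta_space T) (beta_map S T f)"
  unfolding beta_space_def[of T]
proof (rule continuous_on_generated_topo)
  fix U :: "'b set set set"
  assume "U \<in> {{x. ultrafilter_on T x \<and> L \<in> x} | L. L \<subseteq> T}"
  then obtain L where L: "L \<subseteq> T" "U = {x. ultrafilter_on T x \<and> L \<in> x}"
    by blast
  have "beta_map S T f -` U \<inter> topspace (beta_space S) =
      {x. ultrafilter_on S x \<and> f -` L \<inter> S \<in> x}"
    using L ultrafilter_on_beta_map[OF f]
    by (auto simp: topspace_beta_space beta_map_def)
  moreover have "openin (beta_space S) {x. ultrafilter_on S x \<and> f -` L \<inter> S \<in> x}"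
    unfolding beta_space_def by (rule topology_generated_by_Basis) blast
  ultimately show "openin (beta_space S) (beta_map S T f -` U \<inter> topspace (beta_space S))"
    by simp
next
  show "beta_map S T f ` topspace (beta_space S) \<subseteq>
      \<Union> {{x. ultrafilter_on T x \<and> L \<in> x} | L. L \<subseteq> T}"
  proof -
    have "ultrafilter_on T x \<Longrightarrow> T \<in> x" for x
      unfolding ultrafilter_on_def by metis
    then show ?thesis
      using ultrafilter_on_beta_map[OF f] unfolding topspace_beta_space by blast
  qed
qed

end

(* The sets {x. L \<in> x} form a base, and \<beta>f maps {x. L \<in> x} onto {y. f(L) \<in> y}. For the nontrivial
   inclusion choose g : T \<rightarrow> S with image in L that is a section of f over f(L): if f(L) \<in> y, then
   \<beta>g(y) contains L, and \<beta>f(\<beta>g(y)) = y because f \<circ> g is the identity on f(L), a member of y. *)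
theory Submission imports Defs begin

lemma ultrafilter_on_subset: "ultrafilter_on S x \<Longrightarrow> A \<in> x \<Longrightarrow> A \<subseteq> S"
  unfolding ultrafilter_on_def by (meson PowD subsetD)

lemma ultrafilter_on_space: "ultrafilter_on S x \<Longrightarrow> S \<in> x"
  unfolding ultrafilter_on_def by metis

lemma ultrafilter_on_empty: "ultrafilter_on S x \<Longrightarrow> {} \<notin> x"
  unfolding ultrafilter_on_def by metis

lemma ultrafilter_on_Int: "ultrafilter_on S x \<Longrightarrow> A \<in> x \<Longrightarrow> B \<in> x \<Longrightarrow> A \<inter> B \<in> x"
  unfolding ultrafilter_on_def by metis

lemma ultrafilter_on_mono:
  "ultrafilter_on S x \<Longrightarrow> A \<in> x \<Longrightarrow> A \<subseteq> B \<Longrightarrow> B \<subseteq> S \<Longrightarrow> B \<in> x"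
  unfolding ultrafilter_on_def by metis

text \<open>Since \<open>K\<close> is in \<open>x\<close>, a subset of \<open>S\<close> belongs to
  \<open>x\<close> exactly when its trace on \<open>K\<close> does: intersecting with
  \<open>K\<close> stays in \<open>x\<close>, and enlarging the trace gives the set back. So
  equality on a single member of \<open>x\<close> is enough.\<close>

lemma ultrafilter_on_mem_cong:
  assumes x: "ultrafilter_on S x" and "K \<in> x" "A \<subseteq> S" "B \<subseteq> S" and eq: "A \<inter> K = B \<inter> K"
  shows "A \<in> x \<longleftrightarrow> B \<in> x"
proof -
  have "C \<in> x \<longleftrightarrow> C \<inter> K \<in> x" if "C \<subseteq> S" for C
    using ultrafilter_on_Int[OF x _ \<open>K \<in> x\<close>] ultrafilter_on_mono[OF x _ _ that]
    by (meson inf_le1)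
  from this[OF \<open>A \<subseteq> S\<close>] this[OF \<open>B \<subseteq> S\<close>] show ?thesis
    by (simp only: eq)
qed

lemma openin_beta_space_basic:
  "L \<subseteq> S \<Longrightarrow> openin (beta_space S) {x. ultrafilter_on S x \<and> L \<in> x}"
  unfolding beta_space_def by (rule topology_generated_by_Basis) blast

text \<open>The generating sets are only a subbase by definition. They form a base because an
  ultrafilter containing \<open>L \<inter> M\<close> contains both \<open>L\<close> and
  \<open>M\<close>, so two basic neighbourhoods of \<open>x\<close> contain a third; this is the
  intersection case of the induction over the generated topology.\<close>

lemma openin_beta_space_nhd:
  assumes "openin (beta_space S) U" "x \<in> U"
  obtains L where "L \<subseteq> S" "L \<in> x" "{z. ultrafilter_on S z \<and> L \<in> z} \<subseteq> U"
proof -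
  have "generate_topology_on {{x. ultrafilter_on S x \<and> L \<in> x} | L. L \<subseteq> S} U"
    using assms(1) unfolding beta_space_def openin_topology_generated_by_iff .
  moreover have "ultrafilter_on S x"
    using openin_subset[OF assms(1)] assms(2) by (auto simp: topspace_beta_space)
  ultimately have "\<exists>L\<subseteq>S. L \<in> x \<and> {z. ultrafilter_on S z \<and> L \<in> z} \<subseteq> U"
    using assms(2)
  proof (induction rule: generate_topology_on.induct)
    case (Int a b)
    then obtain L M where
      L: "L \<subseteq> S" "L \<in> x" "{z. ultrafilter_on S z \<and> L \<in> z} \<subseteq> a" and
      M: "M \<subseteq> S" "M \<in> x" "{z. ultrafilter_on S z \<and> M \<in> z} \<subseteq> b"
      by auto
    have "L \<in> z \<and> M \<in> z" if "ultrafilter_on S z" "L \<inter> M \<in> z" for z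
      using ultrafilter_on_mono[OF that] L(1) M(1) by simp
    then have "{z. ultrafilter_on S z \<and> L \<inter> M \<in> z} \<subseteq> a \<inter> b"
      using L(3) M(3) by blast
    moreover have "L \<inter> M \<in> x"
      by (rule ultrafilter_on_Int[OF Int.prems(1) L(2) M(2)])
    ultimately show ?case
      using L(1) by blast
  next
    case (UN K)
    then obtain k where "k \<in> K" "x \<in> k" by blast
    with UN.IH[of k] UN.prems show ?case by blast
  qed blast+
  then show thesis
    using that by blast
qed

lemma beta_map_lift:
  assumes f: "f \<in> S \<rightarrow> T" and "L \<subseteq> S" and y: "ultrafilter_on T y" "f ` L \<in> y"
  obtains x where "ultrafilter_on S x" "L \<in> x" "beta_map S T f x = y"
proof -
  \<comment> \<open>Were \<open>L\<close> empty, its image would be the empty set, which is not in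
    \<open>y\<close>. The point \<open>a\<close> serves as the value of \<open>g\<close> off
    f(L).\<close>
  obtain a where "a \<in> L"
    using ultrafilter_on_empty[OF y(1)] y(2) by (cases "L = {}") auto
  define g where "g t = (if t \<in> f ` L then inv_into L f t else a)" for t
  have gL: "g t \<in> L" for t
    using \<open>a \<in> L\<close> by (simp add: g_def inv_into_into)
  have fg: "f (g t) = t" if "t \<in> f ` L" for t
    using that by (simp add: g_def f_inv_into_f)
  have g: "g \<in> T \<rightarrow> S"
    using gL \<open>L \<subseteq> S\<close> by blast
  \<comment> \<open>The default value lies in \<open>L\<close> too, so the preimage of
    \<open>L\<close> is all of \<open>T\<close>, a member of every ultrafilter on
    \<open>T\<close>.\<close>
  have "g -` L \<inter> T = T"
    using gL by blast
  then have "L \<in> beta_map T S g y"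
    using \<open>L \<subseteq> S\<close> ultrafilter_on_space[OF y(1)] by (simp add: beta_map_def)
  moreover have "beta_map S T f (beta_map T S g y) = y"
  proof (rule set_eqI)
    fix B
    \<comment> \<open>The preimage of \<open>B\<close> under the composite of \<open>f\<close> and
      \<open>g\<close> may differ from \<open>B\<close> off f(L), but the two sets agree on f(L),
      which is in \<open>y\<close>.\<close>
    have "g -` (f -` B \<inter> S) \<inter> T \<in> y \<longleftrightarrow> B \<in> y" if "B \<subseteq> T"
    proof (rule ultrafilter_on_mem_cong[OF y _ that])
      show "g -` (f -` B \<inter> S) \<inter> T \<inter> f ` L = B \<inter> f ` L"
      proof (rule set_eqI)
        fix t
        \<comment> \<open>On f(L) the restrictions of the preimages to \<open>S\<close> and
          \<open>T\<close> remove nothing.\<close>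
        have "t \<in> T \<and> g t \<in> S" if "t \<in> f ` L"
          using that gL \<open>L \<subseteq> S\<close> f by blast
        then show "t \<in> g -` (f -` B \<inter> S) \<inter> T \<inter> f ` L \<longleftrightarrow> t \<in> B \<inter> f ` L"
          using fg[of t] by (cases "t \<in> f ` L") simp_all
      qed
    qed (use y(2) in auto)
    \<comment> \<open>A set \<open>B\<close> not contained in \<open>T\<close> lies in neither
      side.\<close>
    then show "B \<in> beta_map S T f (beta_map T S g y) \<longleftrightarrow> B \<in> y"
      using ultrafilter_on_subset[OF y(1)] by (auto simp: beta_map_def)
  qed
  ultimately show thesis
    using that ultrafilter_on_beta_map[OF g y(1)] by blast
qed

lemma beta_map_image_basic:
  assumes f: "f \<in> S \<rightarrow> T" and "L \<subseteq> S"
  shows "beta_map S T f ` {x. ultrafilter_on S x \<and> L \<in> x} = {y. ultrafilter_on T y \<and> f ` L \<in> y}"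
proof
  show "beta_map S T f ` {x. ultrafilter_on S x \<and> L \<in> x} \<subseteq> {y. ultrafilter_on T y \<and> f ` L \<in> y}"
  proof clarify
    fix x assume x: "ultrafilter_on S x" "L \<in> x"
    \<comment> \<open>This set contains \<open>L\<close>, which is in \<open>x\<close>.\<close>
    have "f -` f ` L \<inter> S \<in> x"
      by (rule ultrafilter_on_mono[OF x]) (use \<open>L \<subseteq> S\<close> in auto)
    then show "ultrafilter_on T (beta_map S T f x) \<and> f ` L \<in> beta_map S T f x"
      using ultrafilter_on_beta_map[OF f x(1)] f \<open>L \<subseteq> S\<close> by (auto simp: beta_map_def)
  qed
  show "{y. ultrafilter_on T y \<and> f ` L \<in> y} \<subseteq> beta_map S T f ` {x. ultrafilter_on S x \<and> L \<in> x}"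
  proof clarify
    fix y assume "ultrafilter_on T y" "f ` L \<in> y"
    then obtain x where "ultrafilter_on S x" "L \<in> x" "beta_map S T f x = y"
      by (rule beta_map_lift[OF assms])
    then show "y \<in> beta_map S T f ` {x. ultrafilter_on S x \<and> L \<in> x}"
      by blast
  qed
qed

theorem corollary3p5:
  fixes S :: "'a set" and T :: "'b set" and f :: "'a \<Rightarrow> 'b"
  assumes "f \<in> S \<rightarrow> T"
  shows "open_map (beta_space S) (beta_space T) (beta_map S T f)"
  unfolding open_map_def
proof (intro allI impI)
  fix U assume U: "openin (beta_space S) U"
  show "openin (beta_space T) (beta_map S T f ` U)"
  \<comment> \<open>Openness is checked pointwise: around the image of each \<open>x\<close> in
    \<open>U\<close>, the image of a basic neighbourhood of \<open>x\<close> inside \<open>U\<close>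
    is itself basic open, by \<open>beta_map_image_basic\<close>.\<close>
  proof (subst openin_subopen, clarify)
    fix x assume "x \<in> U"
    then obtain L where L: "L \<subseteq> S" "L \<in> x" "{z. ultrafilter_on S z \<and> L \<in> z} \<subseteq> U"
      using openin_beta_space_nhd[OF U] by blast
    have "ultrafilter_on S x"
      using openin_subset[OF U] \<open>x \<in> U\<close> by (auto simp: topspace_beta_space)
    let ?V = "beta_map S T f ` {z. ultrafilter_on S z \<and> L \<in> z}"
    have "f ` L \<subseteq> T"
      using assms L(1) by blast
    then have "openin (beta_space T) ?V"
      unfolding beta_map_image_basic[OF assms L(1)] by (rule openin_beta_space_basic)
    moreover have "beta_map S T f x \<in> ?V"
      using \<open>ultrafilter_on S x\<close> L(2) by blast
    moreover have "?V \<subseteq> beta_map S T f ` U"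
      using L(3) by blast
    ultimately show "\<exists>V. openin (beta_space T) V \<and> beta_map S T f x \<in> V \<and> V \<subseteq> beta_map S T f ` U"
      by blast
  qed
qed

end
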